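(* For every graph $G$, the following are equivalent: (1) $G$ is hereditary total domishold. (2) $G$ is hereditary $2$-asummable. (3) $G$ is $\{F_1,\ldots,F_{13}\}$-free, where $F_1,\ldots,F_{13}$ are the thirteen graphs listed in the context.
   Context: Graphs are finite, simple and undirected; $N_G(v)$ is the (open) neighborhood of $v$; $\mathbb{R}_+$ is the set of non-negative reals. A total dominating set (TD set) in $G=(V,E)$ is a set $D\subseteq V$ such that every vertex of $G$ has a neighbor in $D$. $G$ is total domishold if there exist $w:V\to\mathbb{R}_+$ and $t\in\mathbb{R}_+$ such that for every $S\subseteq V$: $w(S):=\sum_{x\in S}w(x)\ge t$ if and only if $S$ is a total dominating set in $G$ (graphs with isolated vertices are allowed). $G$ is hereditary total domishold if every induced subgraph of $G$ is total domishold. The neighborhood function of $G=(V,E)$ is the positive (monotone) Boolean function $f_G:\{0,1\}^V\to\{0,1\}$, $f_G(x)=\bigvee_{v\in V}\bigwedge_{u\in N_G(v)}x_u$ (an empty conjunction equals $1$). A positive Boolean function $f$ is $2$-summable if there exist two (not necessarily distinct) false points $x^1,x^2$ of $f$ (i.e. $f(x^i)=0$) and two (not necessarily distinct) true points $y^1,y^2$ of $f$ (i.e. $f(y^i)=1$) with $x^1+x^2=y^1+y^2$ (componentwise integer sum); it is $2$-asummable if it is not $2$-summable. $G$ is $2$-asummable if $f_G$ is $2$-asummable, and hereditary $2$-asummable if every induced subgraph of $G$ is $2$-asummable. $G$ is $\mathcal{F}$-free if it has no induced subgraph isomorphic to a member of $\mathcal{F}$. $K_n,P_n,C_n$ are the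 complete graph, path and cycle on $n$ vertices, $+$ is disjoint union, and $2H=H+H$. The graphs are: $F_1=C_4$; $F_2=C_5$; $F_3=C_6$; $F_4=P_6$; $F_5=2P_3$; $F_6=P_3+K_3$; $F_7=2K_3$; and, on vertex set $\{u,v,a,b,c,d\}$, with the following edge sets: $F_8$: $ua,ub,vc,vd,ac,ab$; $F_9$: $ua,ub,vc,vd,ac,bc,ab$; $F_{10}$: $ua,ub,vc,vd,ac,ab,cd$; $F_{11}$: $ua,ub,vc,vd,ac,bc,ab,cd$; $F_{12}$: $ua,ub,vc,vd,ac,bc,bd,ab,cd$; $F_{13}$: $ua,ub,vc,vd,ac,ad,bc,bd,ab,cd$. *)

theory Defs
  imports Complex_Main "HOL-Library.FuncSet" "Graph_Theory.Graph_Theory"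
begin

text \<open>
  Finite simple undirected graphs are those of the locale \<^locale>\<open>graph\<close>: finite, loop-free,
  symmetric digraphs without parallel arcs, an edge \<open>xy\<close> being the pair of arcs from \<open>x\<close> to \<open>y\<close>
  and from \<open>y\<close> to \<open>x\<close>. The graph without vertices is included.
\<close>

definition neighborhood :: "('a, 'b) pre_digraph \<Rightarrow> 'a \<Rightarrow> 'a set" where
  "neighborhood G v = {u \<in> verts G. v \<rightarrow>\<^bsub>G\<^esub> u}"

definition hereditary :: "(('a, 'b) pre_digraph \<Rightarrow> bool) \<Rightarrow> ('a, 'b) pre_digraph \<Rightarrow> bool" where
  "hereditary P G \<longleftrightarrow> (\<forall>H. induced_subgraph H G \<longrightarrow> P H)"


subsection \<open>Total domishold graphs\<close>

definition total_dominating_set :: "('a, 'b) pre_digraph \<Rightarrow> 'a set \<Rightarrow> bool" where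
  "total_dominating_set G D \<longleftrightarrow>
     D \<subseteq> verts G \<and> (\<forall>v \<in> verts G. \<exists>u \<in> D. u \<in> neighborhood G v)"

definition total_domishold :: "('a, 'b) pre_digraph \<Rightarrow> bool" where
  "total_domishold G \<longleftrightarrow>
     (\<exists>(w :: 'a \<Rightarrow> real) (t :: real).
        (\<forall>v \<in> verts G. 0 \<le> w v) \<and> 0 \<le> t \<and>
        (\<forall>S. S \<subseteq> verts G \<longrightarrow> (t \<le> (\<Sum>x\<in>S. w x) \<longleftrightarrow> total_dominating_set G S)))"


subsection \<open>2-asummable graphs\<close>

text \<open>
  The cube \<open>{0,1}\<^sup>V\<close> is \<open>V \<rightarrow>\<^sub>E (UNIV :: bool set)\<close>, with \<open>True\<close> for 1.
\<close>

definition neighborhood_function :: "('a, 'b) pre_digraph \<Rightarrow> ('a \<Rightarrow> bool) \<Rightarrow> bool" where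
  "neighborhood_function G x \<longleftrightarrow> (\<exists>v \<in> verts G. \<forall>u \<in> neighborhood G v. x u)"

lemma neighborhood_function_positive: "mono (neighborhood_function G)"
  by (auto simp: mono_def neighborhood_function_def)

definition two_summable :: "'a set \<Rightarrow> (('a \<Rightarrow> bool) \<Rightarrow> bool) \<Rightarrow> bool" where
  "two_summable V f \<longleftrightarrow>
     (\<exists>x1 \<in> V \<rightarrow>\<^sub>E UNIV. \<exists>x2 \<in> V \<rightarrow>\<^sub>E UNIV. \<exists>y1 \<in> V \<rightarrow>\<^sub>E UNIV. \<exists>y2 \<in> V \<rightarrow>\<^sub>E UNIV.
        \<not> f x1 \<and> \<not> f x2 \<and> f y1 \<and> f y2 \<and>
        (\<forall>v \<in> V. of_bool (x1 v) + of_bool (x2 v) = (of_bool (y1 v) + of_bool (y2 v) :: int)))"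

definition two_asummable :: "('a, 'b) pre_digraph \<Rightarrow> bool" where
  "two_asummable G \<longleftrightarrow> \<not> two_summable (verts G) (neighborhood_function G)"


subsection \<open>The forbidden induced subgraphs\<close>

text \<open>\<open>E\<close> lists every edge in one, arbitrary, orientation.\<close>

definition undirected :: "'v set \<Rightarrow> 'v rel \<Rightarrow> ('v, 'v \<times> 'v) pre_digraph" where
  "undirected V E = with_proj \<lparr>pverts = V, parcs = E \<union> E\<inverse>\<rparr>"

definition complete_graph :: "nat \<Rightarrow> (nat, nat \<times> nat) pre_digraph" where
  "complete_graph n = undirected {..<n} {(i, j). i < j \<and> j < n}"

definition path_graph :: "nat \<Rightarrow> (nat, nat \<times> nat) pre_digraph" where
  "path_graph n = undirected {..<n} {(i, Suc i) |i. Suc i < n}"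

text \<open>Meaningful for \<open>n \<ge> 3\<close> only.\<close>

definition cycle_graph :: "nat \<Rightarrow> (nat, nat \<times> nat) pre_digraph" where
  "cycle_graph n = undirected {..<n} (insert (n - 1, 0) {(i, Suc i) |i. Suc i < n})"

definition disjoint_union ::
    "('a, 'b) pre_digraph \<Rightarrow> ('c, 'd) pre_digraph \<Rightarrow> ('a + 'c, 'b + 'd) pre_digraph" where
  "disjoint_union G H =
     \<lparr>verts = verts G <+> verts H, arcs = arcs G <+> arcs H,
      tail = map_sum (tail G) (tail H), head = map_sum (head G) (head H)\<rparr>"

datatype six_vertex = vu | vv | va | vb | vc | vd

definition "F1 = cycle_graph 4"
definition "F2 = cycle_graph 5"
definition "F3 = cycle_graph 6"
definition "F4 = path_graph 6"
definition "F5 = disjoint_union (path_graph 3) (path_graph 3)"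
definition "F6 = disjoint_union (path_graph 3) (complete_graph 3)"
definition "F7 = disjoint_union (complete_graph 3) (complete_graph 3)"
definition "F8 = undirected UNIV
  {(vu,va), (vu,vb), (vv,vc), (vv,vd), (va,vc), (va,vb)}"
definition "F9 = undirected UNIV
  {(vu,va), (vu,vb), (vv,vc), (vv,vd), (va,vc), (vb,vc), (va,vb)}"
definition "F10 = undirected UNIV
  {(vu,va), (vu,vb), (vv,vc), (vv,vd), (va,vc), (va,vb), (vc,vd)}"
definition "F11 = undirected UNIV
  {(vu,va), (vu,vb), (vv,vc), (vv,vd), (va,vc), (vb,vc), (va,vb), (vc,vd)}"
definition "F12 = undirected UNIV
  {(vu,va), (vu,vb), (vv,vc), (vv,vd), (va,vc), (vb,vc), (vb,vd), (va,vb), (vc,vd)}"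
definition "F13 = undirected UNIV
  {(vu,va), (vu,vb), (vv,vc), (vv,vd), (va,vc), (va,vd), (vb,vc), (vb,vd), (va,vb), (vc,vd)}"

definition induced_free :: "('c, 'd) pre_digraph \<Rightarrow> ('a, 'b) pre_digraph \<Rightarrow> bool" where
  "induced_free F G \<longleftrightarrow> \<not> (\<exists>H. induced_subgraph H G \<and> digraph_iso H F)"

text \<open>A conjunction rather than a set of graphs, because the vertex types differ.\<close>

definition F1_to_F13_free :: "('a, 'b) pre_digraph \<Rightarrow> bool" where
  "F1_to_F13_free G \<longleftrightarrow>
     induced_free F1 G \<and> induced_free F2 G \<and> induced_free F3 G \<and> induced_free F4 G \<and>
     induced_free F5 G \<and> induced_free F6 G \<and> induced_free F7 G \<and> induced_free F8 G \<and>
     induced_free F9 G \<and> induced_free F10 G \<and> induced_free F11 G \<and> induced_free F12 G \<and>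
     induced_free F13 G"

text \<open>The forbidden graphs are simple graphs.\<close>

lemma graph_undirected:
  assumes "finite V" "E \<subseteq> V \<times> V" "irrefl E"
  shows "graph (undirected V E)"
proof -
  have "finite E" using assms(1,2) by (meson finite_SigmaI finite_subset)
  then show ?thesis
    using assms by unfold_locales
      (auto simp: undirected_def symmetric_def sym_def irrefl_def arc_to_ends_def)
qed

lemma complete_graph_complete: "K\<^bsub>n\<^esub> (complete_graph n)"
proof -
  have "graph (complete_graph n)"
    unfolding complete_graph_def by (rule graph_undirected) (auto simp: irrefl_def)
  then show ?thesis
    unfolding complete_digraph_def by (auto simp: complete_graph_def undirected_def)
qed

lemma graph_path_graph: "graph (path_graph n)"
  unfolding path_graph_def by (rule graph_undirected) (auto simp: irrefl_def)

lemma graph_cycle_graph: "n \<ge> 2 \<Longrightarrow> graph (cycle_graph n)"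
  unfolding cycle_graph_def by (rule graph_undirected) (auto simp: irrefl_def)

lemma graph_disjoint_union:
  assumes "graph G" "graph H"
  shows "graph (disjoint_union G H)"
proof -
  interpret G: graph G by fact
  interpret H: graph H by fact
  show ?thesis
  proof
    show "symmetric (disjoint_union G H)"
      using G.sym_arcs H.sym_arcs
      unfolding symmetric_conv disjoint_union_def by (auto simp: Plus_def bex_Un)
  qed (auto simp: disjoint_union_def arc_to_ends_def G.no_loops H.no_loops
        intro: G.no_multi_arcs H.no_multi_arcs)
qed

lemma graph_F1_to_F13:
  "graph F1" "graph F2" "graph F3" "graph F4" "graph F5" "graph F6" "graph F7"
  "graph F8" "graph F9" "graph F10" "graph F11" "graph F12" "graph F13"
proof -
  have K: "graph (complete_graph n)" for n
    using complete_graph_complete[of n] by (simp add: complete_digraph_def)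
  have fin: "finite (UNIV :: six_vertex set)"
  proof (rule finite_subset)
    show "UNIV \<subseteq> {vu, vv, va, vb, vc, vd}" using six_vertex.exhaust by blast
  qed simp
  show "graph F1" "graph F2" "graph F3" "graph F4" "graph F5" "graph F6" "graph F7"
    by (simp_all add: F1_def F2_def F3_def F4_def F5_def F6_def F7_def
        graph_cycle_graph graph_path_graph graph_disjoint_union K)
  show "graph F8" "graph F9" "graph F10" "graph F11" "graph F12" "graph F13"
    unfolding F8_def F9_def F10_def F11_def F12_def F13_def
    by (rule graph_undirected; simp add: fin irrefl_def)+
qed

end

theory Submission
  imports Defs
begin

text \<open>
  A set of vertices is total dominating exactly if its complement contains no neighborhood. So the
  total dominating sets are described by the family of inclusion-minimal neighborhoods, and the
  three conditions are about how uniform that family is.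

  Weights for the total dominating sets exclude 2-summability: the two false points would have
  complements of weight at least \<open>t\<close> each, the two true points complements of weight below \<open>t\<close>
  each, but the sums agree (\<open>total_domishold_imp_two_asummable\<close>).

  In each forbidden graph two neighborhoods can exchange vertices and become two sets that contain
  no neighborhood, so that the graph is 2-summable (\<open>exchange_certificate_of_forbidden_graph\<close>).

  The remaining step goes from the forbidden graphs to weights. Suppose that there are two
  vertices \<open>a, b \<in> N(u) - N(v)\<close> and two vertices \<open>c, d \<in> N(v) - N(u)\<close>. If \<open>u\<close>, \<open>v\<close> are not adjacent,
  the only undetermined pairs among these six vertices are those inside \<open>{a, b, c, d}\<close>, and every
  way to fill them in creates one of the thirteen graphs (\<open>no_two_cherries\<close>). If \<open>u\<close>, \<open>v\<close> are
  adjacent and their neighborhoods minimal, minimality extends the edge \<open>uv\<close> to a path whose second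
  and fifth vertices are a nonadjacent pair of that kind. Hence any two distinct minimal
  neighborhoods differ, in one of the two directions, by a single vertex; such a family is called
  1-Sperner.

  Finally, every 1-Sperner family is the family of minimal true sets of a threshold function
  (\<open>one_sperner_threshold\<close>). It has a pivot \<open>z\<close>: a vertex such that \<open>e - {z} \<subseteq> f\<close> whenever
  \<open>z \<in> e\<close> and \<open>z \<notin> f\<close> (\<open>pivot_exists\<close>). The family then falls apart into two 1-Sperner families
  on disjoint smaller vertex sets, whose weights are combined by scaling the first ones up.
\<close>

section \<open>1-Sperner families and threshold weights\<close>

definition one_sperner :: "'a set set \<Rightarrow> bool" where
  "one_sperner E \<longleftrightarrow> (\<forall>e\<in>E. \<forall>f\<in>E. e \<noteq> f \<longrightarrow> min (card (e - f)) (card (f - e)) = 1)"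

text \<open>
  The difference sizes \<open>card (e - f)\<close> and \<open>card (f - e)\<close> are ordered like \<open>card e\<close> and \<open>card f\<close>, so
  the minimum is attained by the smaller edge.
\<close>

lemma one_sperner_card_diff:
  assumes "one_sperner E" "e \<in> E" "f \<in> E" "e \<noteq> f" "finite e" "finite f" "card e \<le> card f"
  shows "card (e - f) = 1"
proof -
  have "card (e - f) + card (e \<inter> f) = card e" "card (f - e) + card (e \<inter> f) = card f"
    using assms by (metis card_Int_Diff add.commute Int_commute)+
  moreover have "min (card (e - f)) (card (f - e)) = 1"
    using assms by (auto simp: one_sperner_def)
  ultimately show ?thesis using assms(7) by linarith
qed

text \<open>
  Only differences of edges matter, so that deleting a common part of the edges is harmless.
\<close>

lemma one_sperner_image:
  assumes "one_sperner E" and "\<And>e f. e \<in> E' \<Longrightarrow> f \<in> E' \<Longrightarrow> g e - g f = e - f" and "E' \<subseteq> E"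
  shows "one_sperner (g ` E')"
  unfolding one_sperner_def
proof (intro ballI impI)
  fix e' f' assume "e' \<in> g ` E'" "f' \<in> g ` E'" "e' \<noteq> f'"
  then obtain e f where "e \<in> E'" "f \<in> E'" "e' = g e" "f' = g f" "e \<noteq> f" by blast
  then show "min (card (e' - f')) (card (f' - e')) = 1"
    using assms unfolding one_sperner_def by (metis subsetD)
qed

text \<open>
  Take out an edge \<open>e\<close> of maximal size; by maximality every other edge has exactly one vertex
  outside \<open>e\<close>. A pivot \<open>z\<close> of the remaining family stays a pivot unless \<open>z \<in> e\<close> and \<open>e - {z}\<close> is not
  contained in some edge that avoids \<open>z\<close>. In that case, for an edge \<open>g\<close> through \<open>z\<close> and an
  edge \<open>h\<close> avoiding \<open>z\<close>, the vertex of \<open>g\<close> outside \<open>e\<close> is not \<open>z\<close>, hence lies in \<open>h\<close>. So all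
  remaining edges have the same vertex \<open>x\<close> outside \<open>e\<close>. Since \<open>e\<close> is then the only edge that avoids \<open>x\<close>, the new pivot is \<open>x\<close>.
\<close>

lemma pivot_exists:
  assumes "finite E" "one_sperner E" "\<And>e. e \<in> E \<Longrightarrow> finite e" "\<Union>E \<noteq> {}"
  shows "\<exists>z\<in>\<Union>E. \<forall>e\<in>E. \<forall>f\<in>E. z \<in> e \<longrightarrow> z \<notin> f \<longrightarrow> e - f = {z}"
  using assms
proof (induction "card E" arbitrary: E rule: less_induct)
  case less
  have "E \<noteq> {}" using less.prems(4) by auto
  then obtain e where e: "e \<in> E" "\<And>f. f \<in> E \<Longrightarrow> card f \<le> card e"
    using finite_imageI[OF less.prems(1), of card] Max_in[of "card ` E"] Max_ge[of "card ` E"]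
    by fastforce
  define E' where "E' = E - {e}"
  have outside: "\<exists>x. f - e = {x}" if "f \<in> E'" for f
    using one_sperner_card_diff[OF less.prems(2), of f e] that e less.prems(3)
    by (auto simp: E'_def card_1_singleton_iff)
  show ?case
  proof (cases "E' = {}")
    case True
    then have "E = {e}" using e(1) by (auto simp: E'_def)
    then show ?thesis using less.prems(4) by auto
  next
    case False
    have "\<Union>E' \<noteq> {}" using False outside by blast
    moreover have "card E' < card E" using e less.prems(1) by (simp add: E'_def card_Diff1_less del: card_Diff_insert)
    moreover have "one_sperner E'" using less.prems(2) by (auto simp: one_sperner_def E'_def)
    ultimately obtain z where z: "z \<in> \<Union>E'"
      "\<And>g f. g \<in> E' \<Longrightarrow> f \<in> E' \<Longrightarrow> z \<in> g \<Longrightarrow> z \<notin> f \<Longrightarrow> g - f = {z}"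
      using less.hyps[of E'] less.prems unfolding E'_def by (metis DiffD1 finite_Diff)
    show ?thesis
    proof (cases "\<exists>f\<in>E'. z \<in> e \<and> z \<notin> f \<and> e - f \<noteq> {z}")
      case False
      have "g - f = {z}" if gf: "g \<in> E" "f \<in> E" "z \<in> g" "z \<notin> f" for g f
      proof (cases "g = e")
        case True
        then show ?thesis using False gf unfolding E'_def by blast
      next
        case g: False
        show ?thesis
        proof (cases "f = e")
          case True
          obtain x where "g - e = {x}" using outside[of g] gf g unfolding E'_def by blast
          moreover have "z \<in> g - e" using gf True by blast
          ultimately show ?thesis using True by auto
        next
          case False
          then show ?thesis using z(2)[of g f] gf g by (auto simp: E'_def)
        qed
      qed
      then show ?thesis using z(1) unfolding E'_def by blast
    next
      case True
      then obtain f where f: "f \<in> E'" "z \<in> e" "z \<notin> f" "e - f \<noteq> {z}" by blast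
      obtain x where x: "f - e = {x}" using outside[OF f(1)] by blast
      have through: "g - e = {y} \<Longrightarrow> y \<in> h"
        if "g \<in> E'" "z \<in> g" "h \<in> E'" "z \<notin> h" for g h y
      proof -
        assume "g - e = {y}"
        then have "y \<in> g" "y \<noteq> z" using f(2) by auto
        then show "y \<in> h" using z(2)[OF that(1,3,2,4)] by blast
      qed
      obtain g0 where g0: "g0 \<in> E'" "z \<in> g0" using z(1) by blast
      obtain y where y: "g0 - e = {y}" using outside[OF g0(1)] by blast
      have avoiding: "h - e = {y}" if "h \<in> E'" "z \<notin> h" for h
      proof -
        have "y \<in> h - e" using through[OF g0 that y] y by auto
        then show ?thesis using outside[OF that(1)] by (metis singletonD)
      qed
      then have "x = y" using x f by auto
      have all: "g - e = {x}" if g: "g \<in> E'" for g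
      proof (cases "z \<in> g")
        case True
        obtain y' where y': "g - e = {y'}" using outside[OF g] by blast
        then have "y' \<in> f - e" using through[OF g True f(1,3) y'] by auto
        then show ?thesis using x y' by simp
      next
        case False
        then show ?thesis using avoiding[OF g] \<open>x = y\<close> by simp
      qed
      have "x \<notin> e" "x \<in> f" using x by auto
      have "g - h = {x}" if "g \<in> E" "h \<in> E" "x \<in> g" "x \<notin> h" for g h
      proof -
        have "h = e" using all[of h] that unfolding E'_def by blast
        moreover have "g \<in> E'" using that \<open>x \<notin> e\<close> by (auto simp: E'_def)
        ultimately show ?thesis using all by blast
      qed
      then show ?thesis using \<open>x \<in> f\<close> f(1) unfolding E'_def by blast
    qed
  qed
qed

text \<open>
  For a pivot \<open>z\<close>, let \<open>E1\<close> consist of the edges through \<open>z\<close> with \<open>z\<close> deleted, and \<open>V1\<close> be their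
  union. Edges that avoid \<open>z\<close> contain \<open>V1\<close>; deleting it leaves \<open>E2\<close>, on \<open>V2\<close>. A set \<open>S\<close> with \<open>z\<close>
  contains an edge iff \<open>S \<inter> V1\<close> contains one of \<open>E1\<close>; a set \<open>S\<close> without \<open>z\<close> does iff \<open>V1 \<subseteq> S\<close>
  and \<open>S \<inter> V2\<close> contains one of \<open>E2\<close>. The weights on \<open>V1\<close> are scaled by a factor \<open>N\<close> that
  exceeds everything on \<open>V2\<close>. Their positivity is what the induction needs to tell \<open>V1 \<subseteq> S\<close> from
  the weight of \<open>S \<inter> V1\<close>.
\<close>

lemma one_sperner_threshold:
  assumes "finite V" "\<Union>E \<subseteq> V" "one_sperner E"
  shows "\<exists>(w :: 'a \<Rightarrow> nat) t. (\<forall>x\<in>V. 0 < w x) \<and>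
           (\<forall>S. S \<subseteq> V \<longrightarrow> (t \<le> (\<Sum>x\<in>S. w x) \<longleftrightarrow> (\<exists>e\<in>E. e \<subseteq> S)))"
  using assms
proof (induction "card V" arbitrary: V E rule: less_induct)
  case less
  have "finite E" using less.prems(1,2) by (meson Sup_le_iff Pow_iff finite_Pow_iff finite_subset subsetI)
  have fin: "finite e" if "e \<in> E" for e using that less.prems(1,2) by (meson Sup_le_iff finite_subset)
  show ?case
  proof (cases "\<Union>E = {}")
    case True
    then have "E \<subseteq> {{}}" by auto
    then consider "E = {}" | "E = {{}}" using subset_singletonD by blast
    then show ?thesis
    proof cases
      case 1
      have "\<not> Suc (card V) \<le> card S" if "S \<subseteq> V" for S
        using card_mono[OF less.prems(1) that] by simp
      then show ?thesis using 1 by (intro exI[of _ "\<lambda>_. 1"] exI[of _ "Suc (card V)"]) simp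
    next
      case 2
      then show ?thesis by (intro exI[of _ "\<lambda>_. 1"] exI[of _ 0]) simp
    qed
  next
    case False
    then obtain z where z: "z \<in> \<Union>E"
      and pivot: "\<And>e f. e \<in> E \<Longrightarrow> f \<in> E \<Longrightarrow> z \<in> e \<Longrightarrow> z \<notin> f \<Longrightarrow> e - f = {z}"
      using pivot_exists[OF \<open>finite E\<close> less.prems(3) fin False] by metis
    define E1 where "E1 = (\<lambda>e. e - {z}) ` {e\<in>E. z \<in> e}"
    define V1 where "V1 = \<Union>E1"
    define E2 where "E2 = (\<lambda>f. f - V1) ` {f\<in>E. z \<notin> f}"
    define V2 where "V2 = V - {z} - V1"
    have "z \<in> V" using z less.prems(2) by blast
    have V1: "V1 \<subseteq> V - {z}" using less.prems(2) by (auto simp: V1_def E1_def)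
    have V1_sub: "V1 \<subseteq> f" if "f \<in> E" "z \<notin> f" for f
      using pivot[OF _ that(1) _ that(2)] unfolding V1_def E1_def by blast
    have "card V1 < card V" "card V2 < card V"
      using V1 \<open>z \<in> V\<close> less.prems(1) by (auto simp: V2_def intro!: psubset_card_mono)
    have finV: "finite V1" "finite V2"
      using V1 less.prems(1) finite_subset by (auto simp: V2_def)
    have E1: "\<Union>E1 \<subseteq> V1" "one_sperner E1" unfolding V1_def E1_def
      by (auto intro!: one_sperner_image[OF less.prems(3)])
    obtain w1 :: "'a \<Rightarrow> nat" and t1 where
      w1: "\<And>x. x \<in> V1 \<Longrightarrow> 0 < w1 x"
        "\<And>S. S \<subseteq> V1 \<Longrightarrow> t1 \<le> sum w1 S \<longleftrightarrow> (\<exists>e\<in>E1. e \<subseteq> S)"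
      using less.hyps[OF \<open>card V1 < card V\<close> finV(1) E1] by metis
    have E2: "\<Union>E2 \<subseteq> V2" using less.prems(2) by (auto simp: E2_def V2_def)
    have "one_sperner E2" unfolding E2_def
      by (rule one_sperner_image[OF less.prems(3)]) (use V1_sub in auto)
    then obtain w2 :: "'a \<Rightarrow> nat" and t2 where
      w2: "\<And>x. x \<in> V2 \<Longrightarrow> 0 < w2 x"
        "\<And>S. S \<subseteq> V2 \<Longrightarrow> t2 \<le> sum w2 S \<longleftrightarrow> (\<exists>e\<in>E2. e \<subseteq> S)"
      using less.hyps[OF \<open>card V2 < card V\<close> finV(2) E2] by metis
    define W1 W2 where "W1 = sum w1 V1" and "W2 = sum w2 V2"
    \<comment> \<open>With \<open>z\<close>, missing \<open>t1\<close> by one costs \<open>N\<close>, which outweighs \<open>V2\<close> and the extra 1 in the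
      weight of \<open>z\<close>; that 1 keeps the weight positive if \<open>t1 = W1\<close> and \<open>t2 = 0\<close>.\<close>
    define N where "N = W2 + 2"
    define T where "T = N * W1 + t2"
    define w where "w = (\<lambda>x. if x = z then 1 + N * (W1 - t1) + t2 else if x \<in> V1 then N * w1 x else w2 x)"
    obtain e0 where e0: "e0 \<in> E1" using z by (auto simp: E1_def)
    have "t1 \<le> W1" using w1(2)[of V1] e0 unfolding W1_def V1_def by blast
    have sum_w: "sum w S = (if z \<in> S then 1 + N * (W1 - t1) + t2 else 0) + N * sum w1 (S \<inter> V1) + sum w2 (S \<inter> V2)"
      if "S \<subseteq> V" for S
    proof -
      have "finite S" using that less.prems(1) finite_subset by blast
      have "S = (S \<inter> {z}) \<union> (S \<inter> V1) \<union> (S \<inter> V2)" using that V1 by (auto simp: V2_def)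
      then have "sum w S = sum w ((S \<inter> {z}) \<union> (S \<inter> V1) \<union> (S \<inter> V2))" by simp
      also have "\<dots> = sum w (S \<inter> {z}) + sum w (S \<inter> V1) + sum w (S \<inter> V2)"
        using \<open>finite S\<close> V1 by (subst sum.union_disjoint, auto simp: V2_def)+
      also have "sum w (S \<inter> V1) = N * sum w1 (S \<inter> V1)"
        using V1 unfolding sum_distrib_left by (intro sum.cong) (auto simp: w_def)
      also have "sum w (S \<inter> V2) = sum w2 (S \<inter> V2)"
        by (intro sum.cong) (auto simp: w_def V2_def)
      finally show ?thesis by (auto simp: w_def)
    qed
    have "T \<le> sum w S \<longleftrightarrow> (\<exists>e\<in>E. e \<subseteq> S)" if "S \<subseteq> V" for S
    proof -
      have bound: "sum w1 (S \<inter> V1) \<le> W1" "sum w2 (S \<inter> V2) \<le> W2"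
        unfolding W1_def W2_def by (simp_all add: sum_mono2 finV)
      show ?thesis
      proof (cases "z \<in> S")
        case True
        have "(\<exists>e\<in>E. e \<subseteq> S) \<longleftrightarrow> (\<exists>e\<in>E1. e \<subseteq> S \<inter> V1)"
        proof
          assume "\<exists>e\<in>E. e \<subseteq> S"
          then obtain e where "e \<in> E" "e \<subseteq> S" by blast
          then show "\<exists>e\<in>E1. e \<subseteq> S \<inter> V1"
          proof (cases "z \<in> e")
            case True
            then have "e - {z} \<in> E1" using \<open>e \<in> E\<close> by (auto simp: E1_def)
            moreover from this have "e - {z} \<subseteq> S \<inter> V1" using \<open>e \<subseteq> S\<close> by (auto simp: V1_def)
            ultimately show ?thesis by blast
          next
            case False
            then have "V1 \<subseteq> S" using V1_sub \<open>e \<in> E\<close> \<open>e \<subseteq> S\<close> by blast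
            then show ?thesis using e0 unfolding V1_def by blast
          qed
        qed (use True in \<open>auto simp: E1_def\<close>)
        also have "\<dots> \<longleftrightarrow> t1 \<le> sum w1 (S \<inter> V1)" using w1(2)[of "S \<inter> V1"] by simp
        also have "\<dots> \<longleftrightarrow> T \<le> sum w S"
        proof
          have sum: "sum w S = 1 + N * (W1 - t1) + t2 + N * sum w1 (S \<inter> V1) + sum w2 (S \<inter> V2)"
            using True sum_w[OF that] by simp
          assume "t1 \<le> sum w1 (S \<inter> V1)"
          then have "N * t1 \<le> N * sum w1 (S \<inter> V1)" by (rule mult_le_mono2)
          moreover have "N * W1 = N * (W1 - t1) + N * t1"
            using \<open>t1 \<le> W1\<close> by (metis distrib_left le_add_diff_inverse2)
          ultimately show "T \<le> sum w S" using sum unfolding T_def by linarith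
        next
          assume T: "T \<le> sum w S"
          show "t1 \<le> sum w1 (S \<inter> V1)"
          proof (rule ccontr)
            assume "\<not> ?thesis"
            then have "N * (sum w1 (S \<inter> V1) + 1) \<le> N * t1" by (intro mult_le_mono2) simp
            moreover have "N * W1 = N * (W1 - t1) + N * t1"
              using \<open>t1 \<le> W1\<close> by (metis distrib_left le_add_diff_inverse2)
            ultimately have "sum w S < T"
              using True sum_w[OF that] bound(2) unfolding T_def distrib_left mult_1_right
              by (simp add: N_def)
            then show False using T by simp
          qed
        qed
        finally show ?thesis by simp
      next
        case False
        have "(\<exists>e\<in>E. e \<subseteq> S) \<longleftrightarrow> V1 \<subseteq> S \<and> (\<exists>e\<in>E2. e \<subseteq> S \<inter> V2)"
        proof
          assume "\<exists>e\<in>E. e \<subseteq> S"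
          then obtain e where e: "e \<in> E" "e \<subseteq> S" "z \<notin> e" using False by blast
          then have "e - V1 \<in> E2" "e - V1 \<subseteq> S \<inter> V2" "V1 \<subseteq> S"
            using that V1_sub[of e] by (auto simp: E2_def V2_def)
          then show "V1 \<subseteq> S \<and> (\<exists>e\<in>E2. e \<subseteq> S \<inter> V2)" by blast
        qed (auto simp: E2_def)
        also have "\<dots> \<longleftrightarrow> V1 \<subseteq> S \<and> t2 \<le> sum w2 (S \<inter> V2)" using w2(2)[of "S \<inter> V2"] by simp
        also have "\<dots> \<longleftrightarrow> T \<le> sum w S"
        proof
          assume "V1 \<subseteq> S \<and> t2 \<le> sum w2 (S \<inter> V2)"
          then show "T \<le> sum w S"
            using False sum_w[OF that] by (simp add: T_def W1_def Int_absorb1)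
        next
          assume T: "T \<le> sum w S"
          have "V1 \<subseteq> S"
          proof (rule ccontr)
            assume "\<not> V1 \<subseteq> S"
            then obtain x where "x \<in> V1" "x \<notin> S" by blast
            then have "sum w1 (S \<inter> V1) + w1 x \<le> W1"
              unfolding W1_def using finV
              by (metis (no_types, lifting) Int_iff Int_lower2 add.commute finite_Int insert_subset sum.insert sum_mono2 zero_le)
            then have "N * (sum w1 (S \<inter> V1) + 1) \<le> N * W1"
              using w1(1)[OF \<open>x \<in> V1\<close>] by (intro mult_le_mono2) simp
            then show False using T False sum_w[OF that] bound(2)
              unfolding T_def distrib_left mult_1_right by (simp add: N_def)
          qed
          then show "V1 \<subseteq> S \<and> t2 \<le> sum w2 (S \<inter> V2)"
            using T False sum_w[OF that] by (simp add: T_def W1_def Int_absorb1)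
        qed
        finally show ?thesis by simp
      qed
    qed
    moreover have "0 < w x" if "x \<in> V" for x
      using that w1(1) w2(1) by (auto simp: w_def N_def V2_def)
    ultimately show ?thesis by blast
  qed
qed

section \<open>Exchange certificates\<close>

lemma neighborhood_subset: "neighborhood G v \<subseteq> verts G"
  by (auto simp: neighborhood_def)

text \<open>
  The indicator functions of \<open>X1\<close>, \<open>X2\<close> are false points, those of the neighborhoods of \<open>u\<close>, \<open>v\<close>
  true points; equal union and intersection say that the two pairs have the same sum.
\<close>

definition exchange_certificate ::
    "('a, 'b) pre_digraph \<Rightarrow> 'a \<Rightarrow> 'a \<Rightarrow> 'a set \<Rightarrow> 'a set \<Rightarrow> bool" where
  "exchange_certificate G u v X1 X2 \<longleftrightarrow>
     u \<in> verts G \<and> v \<in> verts G \<and>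
     (\<forall>w\<in>verts G. \<not> neighborhood G w \<subseteq> X1 \<and> \<not> neighborhood G w \<subseteq> X2) \<and>
     X1 \<union> X2 = neighborhood G u \<union> neighborhood G v \<and>
     X1 \<inter> X2 = neighborhood G u \<inter> neighborhood G v"

lemma exchange_certificate_not_two_asummable:
  assumes "exchange_certificate G u v X1 X2"
  shows "\<not> two_asummable G"
proof -
  define \<chi> where "\<chi> X = restrict (\<lambda>x. x \<in> X) (verts G)" for X :: "'a set"
  have f: "neighborhood_function G (\<chi> X) \<longleftrightarrow> (\<exists>w\<in>verts G. neighborhood G w \<subseteq> X)" for X
    using neighborhood_subset[of G] by (fastforce simp: neighborhood_function_def \<chi>_def)
  have sum: "of_bool (\<chi> X1 x) + of_bool (\<chi> X2 x) =
      (of_bool (\<chi> (neighborhood G u) x) + of_bool (\<chi> (neighborhood G v) x) :: int)"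
    if "x \<in> verts G" for x
  proof -
    have "x \<in> X1 \<or> x \<in> X2 \<longleftrightarrow> x \<in> neighborhood G u \<or> x \<in> neighborhood G v"
      "x \<in> X1 \<and> x \<in> X2 \<longleftrightarrow> x \<in> neighborhood G u \<and> x \<in> neighborhood G v"
      using assms unfolding exchange_certificate_def by blast+
    then show ?thesis using that by (auto simp: \<chi>_def)
  qed
  show ?thesis
    unfolding two_asummable_def two_summable_def not_not
  proof (intro bexI conjI ballI)
    show "\<not> neighborhood_function G (\<chi> X1)" "\<not> neighborhood_function G (\<chi> X2)"
      "neighborhood_function G (\<chi> (neighborhood G u))" "neighborhood_function G (\<chi> (neighborhood G v))"
      using assms by (auto simp: f exchange_certificate_def)
  qed (use sum in \<open>auto simp: \<chi>_def\<close>)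
qed

section \<open>Induced embeddings\<close>

text \<open>
  Between simple graphs, such maps are the isomorphisms from \<open>F\<close> onto induced subgraphs of \<open>G\<close>, with
  the names of the arcs forgotten.
\<close>

definition induced_embedding ::
    "('c, 'd) pre_digraph \<Rightarrow> ('a, 'b) pre_digraph \<Rightarrow> ('c \<Rightarrow> 'a) \<Rightarrow> bool" where
  "induced_embedding F G f \<longleftrightarrow>
     inj_on f (verts F) \<and> f ` verts F \<subseteq> verts G \<and>
     (\<forall>x\<in>verts F. \<forall>y\<in>verts F. f x \<rightarrow>\<^bsub>G\<^esub> f y \<longleftrightarrow> x \<rightarrow>\<^bsub>F\<^esub> y)"

lemma dominates_induced_subgraph:
  assumes "induced_subgraph H G" "x \<in> verts H" "y \<in> verts H"
  shows "x \<rightarrow>\<^bsub>H\<^esub> y \<longleftrightarrow> x \<rightarrow>\<^bsub>G\<^esub> y"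
  using assms by (auto simp: induced_subgraph_def subgraph_def compatible_def arcs_ends_conv image_iff)

lemma graph_induced_subgraph:
  assumes "graph G" "induced_subgraph H G"
  shows "graph H"
proof -
  interpret graph G by fact
  have "digraph H" using assms(2) by (rule digraphI_induced)
  moreover have "sym_digraph H" using assms(2) by (rule induced_graph_imp_graph)
  ultimately show ?thesis by (auto intro: digraph.graphI sym_digraph.sym_arcs)
qed

lemma induced_embedding_of_digraph_iso:
  assumes "induced_subgraph H G" "digraph_iso H F"
  obtains f where "induced_embedding F G f"
proof -
  obtain hom where hom: "pre_digraph.digraph_isomorphism H hom" and F: "F = app_iso hom H"
    using assms(2) by (auto simp: digraph_iso_def)
  interpret wf_digraph H using assms(1) by (rule wf_digraphI_induced)
  let ?h = "iso_verts hom"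
  define f where "f = the_inv_into (verts H) ?h"
  have inj: "inj_on ?h (verts H)" using hom by (rule digraph_isomorphism_inj_on_verts)
  have verts: "verts F = ?h ` verts H" by (simp add: F)
  have f: "f (?h x) = x" if "x \<in> verts H" for x
    unfolding f_def using inj that by (rule the_inv_into_f_f)
  have arcs: "x \<rightarrow>\<^bsub>H\<^esub> y \<longleftrightarrow> ?h x \<rightarrow>\<^bsub>F\<^esub> ?h y" if "x \<in> verts H" "y \<in> verts H" for x y
  proof
    assume "?h x \<rightarrow>\<^bsub>F\<^esub> ?h y"
    then obtain x' y' where "x' \<rightarrow>\<^bsub>H\<^esub> y'" "?h x = ?h x'" "?h y = ?h y'"
      unfolding F arcs_ends_app_iso_eq[OF hom] by auto
    then show "x \<rightarrow>\<^bsub>H\<^esub> y" using that adj_in_verts inj by (metis inj_onD)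
  qed (auto simp: F arcs_ends_app_iso_eq[OF hom])
  have "verts H \<subseteq> verts G" using assms(1) by blast
  then have "induced_embedding F G f"
    unfolding induced_embedding_def verts
    using arcs by (auto simp: inj_on_def f dominates_induced_subgraph[OF assms(1)])
  then show ?thesis using that by blast
qed

text \<open>
  Arcs are objects of their own, so an isomorphism must also map them. As there are no parallel
  arcs, each is sent to the unique arc of \<open>F\<close> between the corresponding vertices.
\<close>

lemma digraph_iso_of_induced_embedding:
  assumes "digraph F" "digraph G" "induced_embedding F G f"
  shows "digraph_iso (G \<restriction> f ` verts F) F"
proof -
  interpret F: digraph F by fact
  interpret G: digraph G by fact
  let ?H = "G \<restriction> f ` verts F"
  have emb: "inj_on f (verts F)" "f ` verts F \<subseteq> verts G"
    "\<And>x y. x \<in> verts F \<Longrightarrow> y \<in> verts F \<Longrightarrow> f x \<rightarrow>\<^bsub>G\<^esub> f y \<longleftrightarrow> x \<rightarrow>\<^bsub>F\<^esub> y"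
    using assms(3) by (auto simp: induced_embedding_def)
  have injG: "inj_on (arc_to_ends G) (arcs ?H)"
    using G.inj_on_arc_to_ends by (rule inj_on_subset) auto
  define h where "h = the_inv_into (verts F) f"
  have h: "h (f x) = x" if "x \<in> verts F" for x
    unfolding h_def using emb(1) that by (rule the_inv_into_f_f)
  define k where "k e = the_inv_into (arcs F) (arc_to_ends F) (map_prod h h (arc_to_ends G e))" for e
  have k: "k e \<in> arcs F \<and> arc_to_ends F (k e) = map_prod h h (arc_to_ends G e)"
    if e: "e \<in> arcs ?H" for e
  proof -
    obtain x y where xy: "x \<in> verts F" "y \<in> verts F" "tail G e = f x" "head G e = f y"
      using e by auto
    then have "f x \<rightarrow>\<^bsub>G\<^esub> f y" using e by (auto simp: arcs_ends_conv intro: rev_image_eqI)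
    then have "(x, y) \<in> arc_to_ends F ` arcs F"
      using emb(3) xy by (simp add: arcs_ends_def)
    moreover have "map_prod h h (arc_to_ends G e) = (x, y)"
      using xy by (simp add: arc_to_ends_def h)
    ultimately show ?thesis
      unfolding k_def
      using f_the_inv_into_f[OF F.inj_on_arc_to_ends] the_inv_into_into[OF F.inj_on_arc_to_ends]
      by auto
  qed
  have arcs: "k ` arcs ?H = arcs F"
  proof
    show "k ` arcs ?H \<subseteq> arcs F" using k by auto
    show "arcs F \<subseteq> k ` arcs ?H"
    proof
      fix a assume a: "a \<in> arcs F"
      then have "tail F a \<rightarrow>\<^bsub>F\<^esub> head F a" by (auto simp: arcs_ends_conv)
      then have "f (tail F a) \<rightarrow>\<^bsub>G\<^esub> f (head F a)" using emb(3) a by simp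
      then obtain e where e: "e \<in> arcs G" "tail G e = f (tail F a)" "head G e = f (head F a)"
        by blast
      then have "e \<in> arcs ?H" using a by auto
      moreover have "arc_to_ends F (k e) = arc_to_ends F a"
        using k[OF \<open>e \<in> arcs ?H\<close>] e a by (simp add: arc_to_ends_def h)
      ultimately show "a \<in> k ` arcs ?H"
        using k F.no_multi_arcs a by (metis imageI)
    qed
  qed
  have injk: "inj_on k (arcs ?H)"
  proof (rule inj_onI)
    fix e e' assume ee: "e \<in> arcs ?H" "e' \<in> arcs ?H" "k e = k e'"
    then have "map_prod h h (arc_to_ends G e) = map_prod h h (arc_to_ends G e')" using k by metis
    then have "arc_to_ends G e = arc_to_ends G e'"
      using ee(1,2) by (auto simp: arc_to_ends_def h)
    then show "e = e'" using injG ee by (auto dest: inj_onD)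
  qed
  let ?hom = "\<lparr>iso_verts = h, iso_arcs = k, iso_head = head F, iso_tail = tail F\<rparr>"
  have "wf_digraph ?H" by auto
  moreover have "inj_on h (f ` verts F)" by (auto simp: inj_on_def h)
  moreover have "h (tail G e) = tail F (k e)" "h (head G e) = head F (k e)" if "e \<in> arcs ?H" for e
    using k[OF that] by (auto simp: arc_to_ends_def)
  ultimately have "pre_digraph.digraph_isomorphism ?H ?hom"
    using injk unfolding pre_digraph.digraph_isomorphism_def by simp
  moreover have "h ` f ` verts F = verts F" by (force simp: h)
  then have "F = app_iso ?hom ?H"
    using arcs by (intro pre_digraph.equality) (simp_all add: app_iso_def)
  ultimately show ?thesis unfolding digraph_iso_def by blast
qed

lemma not_induced_free_of_embedding:
  assumes "graph F" "graph G" "induced_embedding F G f"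
  shows "\<not> induced_free F G"
proof -
  interpret F: graph F by fact
  interpret G: graph G by fact
  have "induced_subgraph (G \<restriction> f ` verts F) G"
    using assms(3) by (intro G.induced_induce) (auto simp: induced_embedding_def)
  then show ?thesis
    using digraph_iso_of_induced_embedding[OF F.digraph_axioms G.digraph_axioms assms(3)]
    unfolding induced_free_def by blast
qed

lemma induced_free_induced_subgraph:
  assumes "induced_subgraph H G" "induced_free F G"
  shows "induced_free F H"
proof -
  have "induced_subgraph K G" if "induced_subgraph K H" for K
    using that assms(1)
    by (auto simp: induced_subgraph_def subgraph_def compatible_def)
  then show ?thesis using assms(2) by (auto simp: induced_free_def)
qed

lemma exchange_certificate_embedding:
  assumes "induced_embedding F G f" "wf_digraph G" "exchange_certificate F u v X1 X2"
  shows "exchange_certificate (G \<restriction> f ` verts F) (f u) (f v) (f ` X1) (f ` X2)"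
proof -
  interpret G: wf_digraph G by fact
  let ?H = "G \<restriction> f ` verts F"
  have inj: "inj_on f (verts F)" using assms(1) by (simp add: induced_embedding_def)
  have ind: "induced_subgraph ?H G"
    using assms(1) by (intro G.induced_induce) (auto simp: induced_embedding_def)
  have nb: "neighborhood ?H (f w) = f ` neighborhood F w" if "w \<in> verts F" for w
    using assms(1) that dominates_induced_subgraph[OF ind]
    by (auto simp: neighborhood_def induced_embedding_def)
  have X: "X1 \<subseteq> verts F" "X2 \<subseteq> verts F"
    using assms(3) neighborhood_subset[of F] unfolding exchange_certificate_def by blast+
  have sub: "f ` neighborhood F w \<subseteq> f ` X \<longleftrightarrow> neighborhood F w \<subseteq> X" if "X \<subseteq> verts F" for w X
    using inj_on_image_mem_iff[OF inj _ that] neighborhood_subset[of F w] by blast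
  show ?thesis
    using assms(3)
    by (simp add: exchange_certificate_def nb sub X neighborhood_subset
        flip: image_Un inj_on_image_Int[OF inj])
qed

lemma induced_free_of_exchange_certificate:
  assumes "wf_digraph G" "hereditary two_asummable G" "exchange_certificate F u v X1 X2"
  shows "induced_free F G"
proof (unfold induced_free_def, safe)
  fix H assume "induced_subgraph H G" "digraph_iso H F"
  then obtain f where f: "induced_embedding F G f" by (rule induced_embedding_of_digraph_iso)
  then have "induced_subgraph (G \<restriction> f ` verts F) G"
    using assms(1) by (intro wf_digraph.induced_induce) (auto simp: induced_embedding_def)
  moreover have "\<not> two_asummable (G \<restriction> f ` verts F)"
    using exchange_certificate_embedding[OF f assms(1,3)]
    by (rule exchange_certificate_not_two_asummable)
  ultimately show False using assms(2) by (auto simp: hereditary_def)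
qed

section \<open>Weights of total dominating sets\<close>

lemma total_dominating_set_compl:
  assumes "X \<subseteq> verts G"
  shows "total_dominating_set G (verts G - X) \<longleftrightarrow> (\<forall>v\<in>verts G. \<not> neighborhood G v \<subseteq> X)"
  using neighborhood_subset[of G] unfolding total_dominating_set_def by blast

text \<open>
  Summing the weights of the zeros of the four points contradicts equality of the coordinate sums.
\<close>

lemma total_domishold_imp_two_asummable:
  assumes "finite (verts G)" "total_domishold G"
  shows "two_asummable G"
proof (unfold two_asummable_def two_summable_def, safe)
  let ?V = "verts G" and ?f = "neighborhood_function G"
  fix x1 x2 y1 y2 :: "'a \<Rightarrow> bool"
  assume points: "\<not> ?f x1" "\<not> ?f x2" "?f y1" "?f y2"
    and sum: "\<forall>v\<in>?V. of_bool (x1 v) + of_bool (x2 v) = (of_bool (y1 v) + of_bool (y2 v) :: int)"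
  obtain w :: "'a \<Rightarrow> real" and t where
    w: "\<And>S. S \<subseteq> ?V \<Longrightarrow> t \<le> sum w S \<longleftrightarrow> total_dominating_set G S"
    using assms(2) unfolding total_domishold_def by blast
  let ?zeros = "\<lambda>x. {v\<in>?V. \<not> x v}"
  have f: "?f x \<longleftrightarrow> sum w (?zeros x) < t" for x
  proof -
    have "?zeros x = ?V - {v\<in>?V. x v}" by auto
    then have "t \<le> sum w (?zeros x) \<longleftrightarrow> (\<forall>v\<in>?V. \<not> neighborhood G v \<subseteq> {v\<in>?V. x v})"
      using w[of "?zeros x"] total_dominating_set_compl[of "{v\<in>?V. x v}" G] by auto
    then show ?thesis
      using neighborhood_subset[of G] unfolding neighborhood_function_def by force
  qed
  have zeros: "sum w (?zeros x) = (\<Sum>v\<in>?V. w v * (1 - of_bool (x v)))" for x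
    using assms(1) by (subst sum.inter_filter) (auto intro!: sum.cong)
  have "(1 - of_bool (x1 v)) + (1 - of_bool (x2 v)) = (1 - of_bool (y1 v)) + (1 - of_bool (y2 v) :: real)"
    if "v \<in> ?V" for v
    using bspec[OF sum that] by (auto simp: of_bool_def split: if_splits)
  then have "sum w (?zeros x1) + sum w (?zeros x2) = sum w (?zeros y1) + sum w (?zeros y2)"
    unfolding zeros sum.distrib[symmetric] distrib_left[symmetric] by (intro sum.cong) auto
  then show False using points unfolding f by linarith
qed

text \<open>
  Weights that recognise the sets containing a neighborhood also recognise, with the threshold
  complemented, the complements of the sets that contain none. The truncated subtraction is
  right: the threshold becomes 0 if no set reaches \<open>t\<close>, and then every set is total dominating.
\<close>

lemma total_domishold_of_one_sperner:
  assumes "finite (verts G)" "one_sperner E" "E \<subseteq> neighborhood G ` verts G"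
    and "\<And>v. v \<in> verts G \<Longrightarrow> \<exists>e\<in>E. e \<subseteq> neighborhood G v"
  shows "total_domishold G"
proof -
  let ?V = "verts G"
  have "\<Union>E \<subseteq> ?V" using assms(3) neighborhood_subset[of G] by blast
  then obtain w :: "'a \<Rightarrow> nat" and t where
    w: "\<And>S. S \<subseteq> ?V \<Longrightarrow> t \<le> sum w S \<longleftrightarrow> (\<exists>e\<in>E. e \<subseteq> S)"
    using one_sperner_threshold[OF assms(1) _ assms(2)] by metis
  let ?t = "sum w ?V + 1 - t"
  have "real ?t \<le> (\<Sum>x\<in>S. real (w x)) \<longleftrightarrow> total_dominating_set G S" if "S \<subseteq> ?V" for S
  proof -
    have "S = ?V - (?V - S)" using that by auto
    then have "total_dominating_set G S \<longleftrightarrow> (\<forall>v\<in>?V. \<not> neighborhood G v \<subseteq> ?V - S)"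
      using total_dominating_set_compl[of "?V - S" G] by simp
    also have "\<dots> \<longleftrightarrow> \<not> (\<exists>e\<in>E. e \<subseteq> ?V - S)"
    proof
      assume none: "\<forall>v\<in>?V. \<not> neighborhood G v \<subseteq> ?V - S"
      show "\<not> (\<exists>e\<in>E. e \<subseteq> ?V - S)" using assms(3) none by auto
    next
      assume none: "\<not> (\<exists>e\<in>E. e \<subseteq> ?V - S)"
      show "\<forall>v\<in>?V. \<not> neighborhood G v \<subseteq> ?V - S"
        using assms(4) none by (meson order_trans)
    qed
    also have "\<dots> \<longleftrightarrow> sum w (?V - S) < t" using w[of "?V - S"] by (simp add: not_le[symmetric])
    also have "\<dots> \<longleftrightarrow> ?t \<le> sum w S"
      using sum.subset_diff[OF that assms(1), of w] by linarith
    finally show ?thesis by (metis of_nat_le_iff of_nat_sum)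
  qed
  then show ?thesis
    unfolding total_domishold_def
    by (intro exI[of _ "\<lambda>x. real (w x)"] exI[of _ "real ?t"] conjI ballI allI impI) simp_all
qed

section \<open>The forbidden graphs\<close>

lemma dominates_undirected [simp]:
  "x \<rightarrow>\<^bsub>undirected V E\<^esub> y \<longleftrightarrow> (x, y) \<in> E \<or> (y, x) \<in> E"
  by (simp add: undirected_def)

lemma verts_undirected [simp]: "verts (undirected V E) = V"
  by (simp add: undirected_def)

lemma verts_disjoint_union [simp]: "verts (disjoint_union G H) = verts G <+> verts H"
  by (simp add: disjoint_union_def)

lemma dominates_disjoint_union [simp]:
  "Inl x \<rightarrow>\<^bsub>disjoint_union G H\<^esub> Inl x' \<longleftrightarrow> x \<rightarrow>\<^bsub>G\<^esub> x'"
  "Inr y \<rightarrow>\<^bsub>disjoint_union G H\<^esub> Inr y' \<longleftrightarrow> y \<rightarrow>\<^bsub>H\<^esub> y'"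
  "\<not> Inl x \<rightarrow>\<^bsub>disjoint_union G H\<^esub> Inr y" "\<not> Inr y \<rightarrow>\<^bsub>disjoint_union G H\<^esub> Inl x"
  by (auto simp: disjoint_union_def arcs_ends_conv Plus_def image_iff bex_Un)

lemma UNIV_six_vertex: "UNIV = {vu, vv, va, vb, vc, vd}"
  using six_vertex.exhaust by auto

lemmas F1_to_F13_defs =
  F1_def F2_def F3_def F4_def F5_def F6_def F7_def F8_def F9_def F10_def F11_def F12_def F13_def
  cycle_graph_def path_graph_def complete_graph_def UNIV_six_vertex

lemma exchange_certificateI:
  assumes "u \<in> verts G" "v \<in> verts G" "X1 \<subseteq> verts G" "X2 \<subseteq> verts G"
    and "\<forall>w\<in>verts G. (\<exists>x\<in>verts G. w \<rightarrow>\<^bsub>G\<^esub> x \<and> x \<notin> X1) \<and> (\<exists>x\<in>verts G. w \<rightarrow>\<^bsub>G\<^esub> x \<and> x \<notin> X2)"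
    and "\<forall>x\<in>verts G. (x \<in> X1 \<or> x \<in> X2 \<longleftrightarrow> u \<rightarrow>\<^bsub>G\<^esub> x \<or> v \<rightarrow>\<^bsub>G\<^esub> x) \<and>
                     (x \<in> X1 \<and> x \<in> X2 \<longleftrightarrow> u \<rightarrow>\<^bsub>G\<^esub> x \<and> v \<rightarrow>\<^bsub>G\<^esub> x)"
  shows "exchange_certificate G u v X1 X2"
  using assms unfolding exchange_certificate_def neighborhood_def by blast

text \<open>
  From \<open>F3\<close> on, the chosen vertices are nonadjacent, with two neighbors each and none in common; each
  passes one of them to the other.
\<close>

lemma exchange_certificate_of_forbidden_graph:
  "exchange_certificate F1 0 1 {0, 1} {2, 3}"
  "exchange_certificate F2 0 1 {1, 2} {0, 4}"
  "exchange_certificate F3 0 3 {1, 2} {4, 5}"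
  "exchange_certificate F4 1 4 {0, 3} {2, 5}"
  "exchange_certificate F5 (Inl 1) (Inr 1) {Inl 0, Inr 0} {Inl 2, Inr 2}"
  "exchange_certificate F6 (Inl 1) (Inr 1) {Inl 0, Inr 0} {Inl 2, Inr 2}"
  "exchange_certificate F7 (Inl 1) (Inr 1) {Inl 0, Inr 0} {Inl 2, Inr 2}"
  "exchange_certificate F8 vu vv {va, vc} {vb, vd}"
  "exchange_certificate F9 vu vv {va, vc} {vb, vd}"
  "exchange_certificate F10 vu vv {va, vc} {vb, vd}"
  "exchange_certificate F11 vu vv {va, vc} {vb, vd}"
  "exchange_certificate F12 vu vv {va, vc} {vb, vd}"
  "exchange_certificate F13 vu vv {va, vc} {vb, vd}"
  by (rule exchange_certificateI;
      simp add: F1_to_F13_defs lessThan_nat_numeral lessThan_Suc Plus_def)+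

section \<open>Minimal neighborhoods of graphs without the forbidden subgraphs\<close>

locale forbidden_free_graph = graph +
  assumes forbidden_free: "F1_to_F13_free G"
begin

lemma adj_commute: "x \<rightarrow> y \<longleftrightarrow> y \<rightarrow> x"
  using graph_symmetric by blast

lemma not_adj_self [simp]: "\<not> x \<rightarrow> x"
  using adj_not_same by blast

lemma no_forbidden_embedding:
  "\<not> induced_embedding F1 G f1" "\<not> induced_embedding F2 G f2" "\<not> induced_embedding F3 G f3"
  "\<not> induced_embedding F4 G f4" "\<not> induced_embedding F5 G f5" "\<not> induced_embedding F6 G f6"
  "\<not> induced_embedding F7 G f7" "\<not> induced_embedding F8 G f8" "\<not> induced_embedding F9 G f9"
  "\<not> induced_embedding F10 G f10" "\<not> induced_embedding F11 G f11" "\<not> induced_embedding F12 G f12"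
  "\<not> induced_embedding F13 G f13"
  using forbidden_free not_induced_free_of_embedding[OF _ graph_axioms] graph_F1_to_F13
  unfolding F1_to_F13_free_def by metis+

lemma no_C4:
  assumes "a \<rightarrow> b" "b \<rightarrow> c" "c \<rightarrow> d" "d \<rightarrow> a" "a \<noteq> c" "b \<noteq> d" "\<not> a \<rightarrow> c" "\<not> b \<rightarrow> d"
  shows False
proof -
  have "{a, b, c, d} \<subseteq> verts G" using assms adj_in_verts by blast
  moreover have "distinct [a, b, c, d]" using assms by auto
  ultimately have "induced_embedding F1 G (nth [a, b, c, d])"
    using assms
    by (simp add: induced_embedding_def F1_to_F13_defs lessThan_nat_numeral lessThan_Suc adj_commute; blast)
  then show False using no_forbidden_embedding by blast
qed

lemma no_C5:
  assumes "a \<rightarrow> b" "b \<rightarrow> c" "c \<rightarrow> d" "d \<rightarrow> e" "e \<rightarrow> a" "distinct [a, b, c, d, e]"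
    "\<not> a \<rightarrow> c" "\<not> a \<rightarrow> d" "\<not> b \<rightarrow> d" "\<not> b \<rightarrow> e" "\<not> c \<rightarrow> e"
  shows False
proof -
  have "{a, b, c, d, e} \<subseteq> verts G" using assms adj_in_verts by blast
  then have "induced_embedding F2 G (nth [a, b, c, d, e])"
    using assms
    by (simp add: induced_embedding_def F1_to_F13_defs lessThan_nat_numeral lessThan_Suc adj_commute; blast)
  then show False using no_forbidden_embedding by blast
qed

text \<open>
  Two paths \<open>a - u - b\<close> and \<open>c - v - d\<close>, neither centre adjacent to the other path; adjacency inside
  \<open>{a, b, c, d}\<close> is left open.
\<close>

definition two_cherries :: "'a \<Rightarrow> 'a \<Rightarrow> 'a \<Rightarrow> 'a \<Rightarrow> 'a \<Rightarrow> 'a \<Rightarrow> bool" where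
  "two_cherries u v a b c d \<longleftrightarrow>
     distinct [u, v, a, b, c, d] \<and> u \<rightarrow> a \<and> u \<rightarrow> b \<and> v \<rightarrow> c \<and> v \<rightarrow> d \<and> \<not> u \<rightarrow> v \<and>
     \<not> u \<rightarrow> c \<and> \<not> u \<rightarrow> d \<and> \<not> v \<rightarrow> a \<and> \<not> v \<rightarrow> b"

lemma two_cherries_symmetries:
  assumes "two_cherries u v a b c d"
  shows "two_cherries u v b a c d" "two_cherries u v a b d c" "two_cherries v u c d a b"
  using assms adj_commute by (auto simp: two_cherries_def)

lemma two_cherries_verts:
  "two_cherries u v a b c d \<Longrightarrow> {u, v, a, b, c, d} \<subseteq> verts G"
  unfolding two_cherries_def using adj_in_verts by blast

lemmas two_cherries_embedding_simps =
  induced_embedding_def F1_to_F13_defs lessThan_nat_numeral lessThan_Suc Plus_def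
  two_cherries_def adj_commute

text \<open>
  The six lemmas that follow are sorted by the edges between \<open>{a, b}\<close> and \<open>{c, d}\<close>, up to the
  symmetries above; inside each, the edges \<open>ab\<close> and \<open>cd\<close> decide which graph appears.
\<close>

lemma no_cross_edge:
  assumes "two_cherries u v a b c d"
    and "\<not> a \<rightarrow> c" "\<not> a \<rightarrow> d" "\<not> b \<rightarrow> c" "\<not> b \<rightarrow> d"
  shows False
proof -
  note verts = two_cherries_verts[OF assms(1)]
  have "\<not> (\<not> a \<rightarrow> b \<and> \<not> c \<rightarrow> d)"
  proof
    assume "\<not> a \<rightarrow> b \<and> \<not> c \<rightarrow> d"
    then have "induced_embedding F5 G (case_sum (nth [a, u, b]) (nth [c, v, d]))"
      using assms verts by (simp add: two_cherries_embedding_simps; blast)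
    then show False using no_forbidden_embedding by blast
  qed
  moreover
  have "\<not> (a \<rightarrow> b \<and> \<not> c \<rightarrow> d)"
  proof
    assume "a \<rightarrow> b \<and> \<not> c \<rightarrow> d"
    then have "induced_embedding F6 G (case_sum (nth [c, v, d]) (nth [a, u, b]))"
      using assms verts by (simp add: two_cherries_embedding_simps; blast)
    then show False using no_forbidden_embedding by blast
  qed
  moreover
  have "\<not> (\<not> a \<rightarrow> b \<and> c \<rightarrow> d)"
  proof
    assume "\<not> a \<rightarrow> b \<and> c \<rightarrow> d"
    then have "induced_embedding F6 G (case_sum (nth [a, u, b]) (nth [c, v, d]))"
      using assms verts by (simp add: two_cherries_embedding_simps; blast)
    then show False using no_forbidden_embedding by blast
  qed
  moreover
  have "\<not> (a \<rightarrow> b \<and> c \<rightarrow> d)"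
  proof
    assume "a \<rightarrow> b \<and> c \<rightarrow> d"
    then have "induced_embedding F7 G (case_sum (nth [a, u, b]) (nth [c, v, d]))"
      using assms verts by (simp add: two_cherries_embedding_simps; blast)
    then show False using no_forbidden_embedding by blast
  qed
  ultimately show False by blast
qed

lemma one_cross_edge:
  assumes "two_cherries u v a b c d"
    and "a \<rightarrow> c" "\<not> a \<rightarrow> d" "\<not> b \<rightarrow> c" "\<not> b \<rightarrow> d"
  shows False
proof -
  note verts = two_cherries_verts[OF assms(1)]
  have "\<not> (\<not> a \<rightarrow> b \<and> \<not> c \<rightarrow> d)"
  proof
    assume "\<not> a \<rightarrow> b \<and> \<not> c \<rightarrow> d"
    then have "induced_embedding F4 G (nth [b, u, a, c, v, d])"
      using assms verts by (simp add: two_cherries_embedding_simps; blast)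
    then show False using no_forbidden_embedding by blast
  qed
  moreover
  have "\<not> (a \<rightarrow> b \<and> \<not> c \<rightarrow> d)"
  proof
    assume "a \<rightarrow> b \<and> \<not> c \<rightarrow> d"
    then have "induced_embedding F8 G (case_six_vertex u v a b c d)"
      using assms verts by (simp add: two_cherries_embedding_simps; blast)
    then show False using no_forbidden_embedding by blast
  qed
  moreover
  have "\<not> (\<not> a \<rightarrow> b \<and> c \<rightarrow> d)"
  proof
    assume "\<not> a \<rightarrow> b \<and> c \<rightarrow> d"
    then have "induced_embedding F8 G (case_six_vertex v u c d a b)"
      using assms verts by (simp add: two_cherries_embedding_simps; blast)
    then show False using no_forbidden_embedding by blast
  qed
  moreover
  have "\<not> (a \<rightarrow> b \<and> c \<rightarrow> d)"
  proof
    assume "a \<rightarrow> b \<and> c \<rightarrow> d"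
    then have "induced_embedding F10 G (case_six_vertex u v a b c d)"
      using assms verts by (simp add: two_cherries_embedding_simps; blast)
    then show False using no_forbidden_embedding by blast
  qed
  ultimately show False by blast
qed

lemma two_disjoint_cross_edges:
  assumes "two_cherries u v a b c d"
    and "a \<rightarrow> c" "\<not> a \<rightarrow> d" "\<not> b \<rightarrow> c" "b \<rightarrow> d"
  shows False
proof -
  note verts = two_cherries_verts[OF assms(1)]
  have "\<not> (a \<rightarrow> b \<and> \<not> c \<rightarrow> d)"
    using assms no_C5[of a c v d b] adj_commute unfolding two_cherries_def by auto
  moreover
  have "\<not> (\<not> a \<rightarrow> b \<and> c \<rightarrow> d)"
    using assms no_C5[of c a u b d] adj_commute unfolding two_cherries_def by auto
  moreover
  have "\<not> (a \<rightarrow> b \<and> c \<rightarrow> d)"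
    using assms no_C4[of a c d b] adj_commute unfolding two_cherries_def by auto
  moreover
  have "\<not> (\<not> a \<rightarrow> b \<and> \<not> c \<rightarrow> d)"
  proof
    assume "\<not> a \<rightarrow> b \<and> \<not> c \<rightarrow> d"
    then have "induced_embedding F3 G (nth [u, a, c, v, d, b])"
      using assms verts by (simp add: two_cherries_embedding_simps; blast)
    then show False using no_forbidden_embedding by blast
  qed
  ultimately show False by blast
qed

lemma two_adjacent_cross_edges:
  assumes "two_cherries u v a b c d"
    and "a \<rightarrow> c" "\<not> a \<rightarrow> d" "b \<rightarrow> c" "\<not> b \<rightarrow> d"
  shows False
proof -
  note verts = two_cherries_verts[OF assms(1)]
  have "a \<rightarrow> b"
    using assms no_C4[of u a c b] adj_commute unfolding two_cherries_def by auto
  moreover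
  have "\<not> (a \<rightarrow> b \<and> \<not> c \<rightarrow> d)"
  proof
    assume "a \<rightarrow> b \<and> \<not> c \<rightarrow> d"
    then have "induced_embedding F9 G (case_six_vertex u v a b c d)"
      using assms verts by (simp add: two_cherries_embedding_simps; blast)
    then show False using no_forbidden_embedding by blast
  qed
  moreover
  have "\<not> (a \<rightarrow> b \<and> c \<rightarrow> d)"
  proof
    assume "a \<rightarrow> b \<and> c \<rightarrow> d"
    then have "induced_embedding F11 G (case_six_vertex u v a b c d)"
      using assms verts by (simp add: two_cherries_embedding_simps; blast)
    then show False using no_forbidden_embedding by blast
  qed
  ultimately show False by blast
qed

lemma three_cross_edges:
  assumes "two_cherries u v a b c d"
    and "a \<rightarrow> c" "\<not> a \<rightarrow> d" "b \<rightarrow> c" "b \<rightarrow> d"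
  shows False
proof -
  note verts = two_cherries_verts[OF assms(1)]
  have "a \<rightarrow> b"
    using assms no_C4[of u a c b] adj_commute unfolding two_cherries_def by auto
  moreover
  have "c \<rightarrow> d"
    using assms no_C4[of v c b d] adj_commute unfolding two_cherries_def by auto
  moreover
  have "\<not> (a \<rightarrow> b \<and> c \<rightarrow> d)"
  proof
    assume "a \<rightarrow> b \<and> c \<rightarrow> d"
    then have "induced_embedding F12 G (case_six_vertex u v a b c d)"
      using assms verts by (simp add: two_cherries_embedding_simps; blast)
    then show False using no_forbidden_embedding by blast
  qed
  ultimately show False by blast
qed

lemma four_cross_edges:
  assumes "two_cherries u v a b c d"
    and "a \<rightarrow> c" "a \<rightarrow> d" "b \<rightarrow> c" "b \<rightarrow> d"
  shows False
proof -
  note verts = two_cherries_verts[OF assms(1)]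
  have "a \<rightarrow> b"
    using assms no_C4[of u a c b] adj_commute unfolding two_cherries_def by auto
  moreover
  have "c \<rightarrow> d"
    using assms no_C4[of v c a d] adj_commute unfolding two_cherries_def by auto
  moreover
  have "\<not> (a \<rightarrow> b \<and> c \<rightarrow> d)"
  proof
    assume "a \<rightarrow> b \<and> c \<rightarrow> d"
    then have "induced_embedding F13 G (case_six_vertex u v a b c d)"
      using assms verts by (simp add: two_cherries_embedding_simps; blast)
    then show False using no_forbidden_embedding by blast
  qed
  ultimately show False by blast
qed

lemma no_two_cherries: "\<not> two_cherries u v a b c d"
proof
  assume "two_cherries u v a b c d"
  \<comment> \<open>The eight symmetries bring each of the sixteen sets of cross edges into a form treated above.\<close>
  note ab = this two_cherries_symmetries(1)[OF this]
  note abcd = ab ab[THEN two_cherries_symmetries(2)]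
  note tc = abcd abcd[THEN two_cherries_symmetries(3)]
  note excluded = tc[THEN no_cross_edge] tc[THEN one_cross_edge]
    tc[THEN two_disjoint_cross_edges] tc[THEN two_adjacent_cross_edges]
    tc[THEN three_cross_edges] tc[THEN four_cross_edges]
  show False
    using excluded adj_commute[of a c] adj_commute[of a d] adj_commute[of b c] adj_commute[of b d]
    by argo
qed

lemma two_elements:
  assumes "finite A" "2 \<le> card A"
  obtains x y where "x \<in> A" "y \<in> A" "x \<noteq> y"
  using assms card_le_Suc0_iff_eq[of A] by fastforce

lemma nonadjacent_neighborhoods:
  assumes "u \<in> verts G" "v \<in> verts G" "\<not> u \<rightarrow> v"
    "2 \<le> card (neighborhood G u - neighborhood G v)" "2 \<le> card (neighborhood G v - neighborhood G u)"
  shows False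
proof -
  have fin: "finite (neighborhood G x - neighborhood G y)" for x y
    using finite_subset[OF neighborhood_subset finite_verts] by blast
  obtain a b where ab: "a \<in> neighborhood G u - neighborhood G v" "b \<in> neighborhood G u - neighborhood G v" "a \<noteq> b"
    using two_elements[OF fin assms(4)] .
  obtain c d where cd: "c \<in> neighborhood G v - neighborhood G u" "d \<in> neighborhood G v - neighborhood G u" "c \<noteq> d"
    using two_elements[OF fin assms(5)] .
  have "two_cherries u v a b c d"
    using ab cd assms(3) adj_commute[of u v] by (auto simp: two_cherries_def neighborhood_def)
  then show False using no_two_cherries by blast
qed

definition minimal_neighborhoods :: "'a set set" where
  "minimal_neighborhoods =
     {neighborhood G v |v. v \<in> verts G \<and> (\<forall>w\<in>verts G. \<not> neighborhood G w \<subset> neighborhood G v)}"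

lemma minimal_neighborhood_below:
  assumes "v \<in> verts G"
  shows "\<exists>e\<in>minimal_neighborhoods. e \<subseteq> neighborhood G v"
proof -
  have "finite (neighborhood G ` verts G)" by simp
  then obtain u where u: "u \<in> verts G" "neighborhood G u \<subseteq> neighborhood G v"
    "\<forall>f\<in>neighborhood G ` verts G. f \<subseteq> neighborhood G u \<longrightarrow> neighborhood G u = f"
    using finite_has_minimal2[of "neighborhood G ` verts G" "neighborhood G v"] assms by auto
  then have "neighborhood G u \<in> minimal_neighborhoods"
    unfolding minimal_neighborhoods_def by blast
  then show ?thesis using u(2) by blast
qed

text \<open>
  A neighbor \<open>b\<close> of \<open>u\<close> only and a neighbor \<open>c\<close> of \<open>v\<close> only form an induced path \<open>b - u - v - c\<close>.
  Since \<open>c\<close> lies in \<open>N(v)\<close> but not in \<open>N(b)\<close>, minimality of \<open>N(v)\<close> forbids \<open>N(b) \<subseteq> N(v)\<close>, so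
  \<open>b\<close> has a neighbor \<open>p\<close> that is not adjacent to \<open>v\<close>; symmetrically, \<open>c\<close> has a neighbor \<open>q\<close> not
  adjacent to \<open>u\<close>. Short cycles being excluded, \<open>p - b - u\<close> and \<open>v - c - q\<close> are two cherries with
  the nonadjacent centres \<open>b\<close> and \<open>c\<close>.
\<close>

lemma adjacent_minimal_neighborhoods:
  assumes "u \<rightarrow> v"
    and min: "\<And>w. w \<in> verts G \<Longrightarrow> \<not> neighborhood G w \<subset> neighborhood G u"
      "\<And>w. w \<in> verts G \<Longrightarrow> \<not> neighborhood G w \<subset> neighborhood G v"
    and card: "2 \<le> card (neighborhood G u - neighborhood G v)" "2 \<le> card (neighborhood G v - neighborhood G u)"
  shows False
proof -
  have fin: "finite (neighborhood G x - neighborhood G y)" for x y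
    using finite_subset[OF neighborhood_subset finite_verts] by blast
  have in_nb: "y \<in> neighborhood G x \<longleftrightarrow> x \<rightarrow> y" for x y
    using adj_in_verts by (auto simp: neighborhood_def)
  have neq: "x \<noteq> y" if "x \<rightarrow> y" for x y using that by auto
  obtain b where b: "u \<rightarrow> b" "\<not> v \<rightarrow> b" "b \<noteq> v"
    using two_elements[OF fin card(1)] in_nb by (metis DiffD1 DiffD2)
  obtain c where c: "v \<rightarrow> c" "\<not> u \<rightarrow> c" "c \<noteq> u"
    using two_elements[OF fin card(2)] in_nb by (metis DiffD1 DiffD2)
  have "b \<noteq> c" using b c by auto
  have "\<not> b \<rightarrow> c"
    using no_C4[of b u v c] assms(1) b c adj_commute by metis
  obtain p where p: "b \<rightarrow> p" "\<not> v \<rightarrow> p"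
    using min(2)[of b] b c \<open>\<not> b \<rightarrow> c\<close> in_nb adj_in_verts by (metis psubsetI subsetI)
  obtain q where q: "c \<rightarrow> q" "\<not> u \<rightarrow> q"
    using min(1)[of c] b c \<open>\<not> b \<rightarrow> c\<close> in_nb adj_in_verts adj_commute by (metis psubsetI subsetI)
  have "p \<noteq> u" "p \<noteq> v" "p \<noteq> c" "q \<noteq> v" "q \<noteq> u" "q \<noteq> b"
    using assms(1) b c p q \<open>\<not> b \<rightarrow> c\<close> adj_commute by metis+
  have "\<not> c \<rightarrow> p"
  proof
    assume "c \<rightarrow> p"
    show False
    proof (cases "u \<rightarrow> p")
      case True
      then show False
        using no_C4[of u v c p] assms(1) c p \<open>c \<rightarrow> p\<close> \<open>p \<noteq> v\<close> adj_commute by metis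
    next
      case False
      then show False
        using no_C5[of p b u v c] assms(1) b c p \<open>c \<rightarrow> p\<close> \<open>\<not> b \<rightarrow> c\<close> \<open>b \<noteq> c\<close> adj_commute neq
        by auto
    qed
  qed
  moreover have "\<not> b \<rightarrow> q"
  proof
    assume "b \<rightarrow> q"
    show False
    proof (cases "v \<rightarrow> q")
      case True
      then show False
        using no_C4[of v u b q] assms(1) b q \<open>b \<rightarrow> q\<close> \<open>q \<noteq> u\<close> adj_commute by metis
    next
      case False
      then show False
        using no_C5[of q c v u b] assms(1) b c q \<open>b \<rightarrow> q\<close> \<open>\<not> b \<rightarrow> c\<close> \<open>b \<noteq> c\<close> adj_commute neq
        by auto
    qed
  qed
  ultimately have "two_cherries b c p u v q"
    using assms(1) b c p q \<open>\<not> b \<rightarrow> c\<close> \<open>b \<noteq> c\<close> \<open>p \<noteq> u\<close> \<open>q \<noteq> v\<close> \<open>p \<noteq> v\<close> \<open>p \<noteq> c\<close> \<open>q \<noteq> u\<close> \<open>q \<noteq> b\<close> adj_commute neq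
    unfolding two_cherries_def by auto
  then show False using no_two_cherries by blast
qed

lemma one_sperner_minimal_neighborhoods: "one_sperner minimal_neighborhoods"
proof (unfold one_sperner_def, intro ballI impI)
  fix e f assume ef: "e \<in> minimal_neighborhoods" "f \<in> minimal_neighborhoods" "e \<noteq> f"
  then obtain u v where
    u: "u \<in> verts G" "e = neighborhood G u" "\<forall>w\<in>verts G. \<not> neighborhood G w \<subset> neighborhood G u" and
    v: "v \<in> verts G" "f = neighborhood G v" "\<forall>w\<in>verts G. \<not> neighborhood G w \<subset> neighborhood G v"
    unfolding minimal_neighborhoods_def mem_Collect_eq by (elim exE conjE)
  have "finite e" "finite f"
    using u(2) v(2) finite_subset[OF neighborhood_subset finite_verts] by auto
  moreover have "e - f \<noteq> {}" "f - e \<noteq> {}" using u v ef(3) by auto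
  ultimately have "card (e - f) \<noteq> 0" "card (f - e) \<noteq> 0" by auto
  moreover have "\<not> (2 \<le> card (e - f) \<and> 2 \<le> card (f - e))"
    using nonadjacent_neighborhoods[of u v] adjacent_minimal_neighborhoods[of u v] u v by blast
  ultimately show "min (card (e - f)) (card (f - e)) = 1" by linarith
qed

lemma total_domishold_graph: "total_domishold G"
proof (rule total_domishold_of_one_sperner)
  show "minimal_neighborhoods \<subseteq> neighborhood G ` verts G"
    by (auto simp: minimal_neighborhoods_def)
qed (simp_all add: one_sperner_minimal_neighborhoods minimal_neighborhood_below)

end

theorem theorem5p2:
  fixes G :: "('a, 'b) pre_digraph"
  assumes "graph G"
  shows "(hereditary total_domishold G \<longleftrightarrow> hereditary two_asummable G) \<and>
         (hereditary two_asummable G \<longleftrightarrow> F1_to_F13_free G)"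
proof -
  interpret graph G by fact
  have "two_asummable H" if "induced_subgraph H G" "total_domishold H" for H
    using that(2) graph_induced_subgraph[OF assms that(1)]
    by (intro total_domishold_imp_two_asummable fin_digraph.finite_verts)
      (simp_all add: graph_def digraph_def)
  then have "hereditary total_domishold G \<Longrightarrow> hereditary two_asummable G"
    by (auto simp: hereditary_def)
  moreover have "F1_to_F13_free G" if "hereditary two_asummable G"
    unfolding F1_to_F13_free_def
    using exchange_certificate_of_forbidden_graph[THEN
        induced_free_of_exchange_certificate[OF wf_digraph that]]
    by blast
  moreover have "hereditary total_domishold G" if "F1_to_F13_free G"
    unfolding hereditary_def
  proof (intro allI impI)
    fix H assume H: "induced_subgraph H G"
    have "F1_to_F13_free H"
      using that by (auto simp: F1_to_F13_free_def intro: induced_free_induced_subgraph[OF H])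
    then interpret H: forbidden_free_graph H
      using graph_induced_subgraph[OF assms H]
      by (simp add: forbidden_free_graph_def forbidden_free_graph_axioms_def)
    show "total_domishold H" by (rule H.total_domishold_graph)
  qed
  ultimately show ?thesis by blast
qed

end
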